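(* Let $m$ be a positive integer and $0\le j\le m-1$. For all $r\in\mathbb{Z}$, $$\mathscr{F}_r^{(m,m-j)}=\sum_{k=0}^{j}\binom{j+k+1}{2k+1}\mathscr{F}_{r-k}^{(m,m)},\qquad \mathscr{G}_r^{(m,m-j)}=-\sum_{k=0}^{j}\binom{j+k}{2k}\mathscr{F}_{r-k}^{(m,m)},$$ so that each term of the sequence $\mathscr{F}^{(m,j')}$ ($1\le j'\le m$) is a binomial coefficient linear combination of $m+1-j'$ terms of the sequence $\mathscr{F}^{(m,m)}$; in particular $\mathscr{F}_r^{(m,m)}=-\mathscr{G}_r^{(m,m)}$ for all $r\in\mathbb{Z}$. The generating functions are $$\sum_{r=0}^\infty\mathscr{F}_{r+1}^{(m,m-j)}x^r=\frac{(2m+1)\,\mathcal{Q}_j(x)}{P_m(x)},\qquad \sum_{r=0}^\infty\mathscr{G}_{r+1}^{(m,m-j)}x^r=-\frac{(2m+1)\,\mathcal{P}_j(x)}{P_m(x)},$$ and the sum of the coefficients of each of the numerator polynomials $\mathcal{Q}_j(x)$, $\mathcal{P}_j(x)$ is a Fibonacci number. Conversely, for all $r\in\mathbb{Z}$, $$\mathscr{F}_r^{(m,j)}=\sum_{k=0}^{j-1}\frac{2j-1}{2k+1}\binom{j+k-1}{2k}\mathscr{F}_{r-k}^{(m,1)},\qquad 1\le j\le m,$$ $$\mathscr{G}_r^{(m,j)}=2\mathscr{F}_r^{(m,1)}+\sum_{k=1}^{j}\frac{j}{k}\binom{j+k-1}{2k-1}\mathscr{F}_{r-k}^{(m,1)},\qquad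 1\le j\le m-1.$$
   Context: For an integer $m\ge0$: $P_m(x)=\sum_{k=0}^{m}\frac{2m+1}{2k+1}\binom{m+k}{2k}x^{k}$, $\mathcal{P}_m(x)=\sum_{k=0}^{m}\binom{m+k}{2k}x^{k}$, $\mathcal{Q}_m(x)=\sum_{k=0}^{m}\binom{m+k+1}{2k+1}x^k$. Rational interlacing Fibonacci sequences of dimension $m\ge1$. Let $h_k=\frac1{2k+1}\binom{m+k}{2k}$ and let $R_m$ be the $m\times m$ matrix whose first column is $(-h_1,-h_2,\dots,-h_m)^T$, whose entries $(i,i+1)$, $1\le i\le m-1$, equal $1$, and whose other entries are $0$ (it is invertible). Let $B_{\rm odd}$, $B_{\rm even}$ be the $m\times m$ matrices with $(i,j)$ entries $(-1)^{i+j-1}\binom{2j-1}{j-i}$ and $(-1)^{i+j}\binom{2j}{j-i}$ respectively (binomial coefficients with negative lower entry are $0$). For $r\in\mathbb{Z}$, the $j$-th row of $(2m+1)B_{\rm odd}R_m^{m+r}$ is $(\mathscr{F}_{r+m}^{(m,j)},\mathscr{F}_{r+m-1}^{(m,j)},\dots,\mathscr{F}_{r+1}^{(m,j)})$ and the $j$-th row of $(2m+1)B_{\rm even}R_m^{m+r}$ is $(\mathscr{G}_{r+m}^{(m,j)},\dots,\mathscr{G}_{r+1}^{(m,j)})$, $1\le j\le m$. Equivalently, $\mathscr{F}_r^{(m,j)}$ (resp. $\mathscr{G}_r^{(m,j)}$) is the $(j,1)$ entry of $(2m+1)B_{\rm odd}R_m^{r}$ (resp. $(2m+1)B_{\rm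 even}R_m^{r}$) for every $r\in\mathbb{Z}$. *)

theory Defs
  imports
    "HOL-Computational_Algebra.Polynomial_FPS"
    "HOL-Number_Theory.Fib"
    "Jordan_Normal_Form.Determinant"
begin

definition P_poly :: "nat \<Rightarrow> rat poly" where
  "P_poly m = (\<Sum>k\<le>m. monom (of_nat (2 * m + 1) / of_nat (2 * k + 1) * of_nat ((m + k) choose (2 * k))) k)"

definition calP_poly :: "nat \<Rightarrow> rat poly" where
  "calP_poly m = (\<Sum>k\<le>m. monom (of_nat ((m + k) choose (2 * k))) k)"

definition calQ_poly :: "nat \<Rightarrow> rat poly" where
  "calQ_poly m = (\<Sum>k\<le>m. monom (of_nat ((m + k + 1) choose (2 * k + 1))) k)"

definition h_coeff :: "nat \<Rightarrow> nat \<Rightarrow> rat" where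
  "h_coeff m k = 1 / of_nat (2 * k + 1) * of_nat ((m + k) choose (2 * k))"

(* The type rat mat is indexed from 0: the entry at (a, b) below is the entry (a + 1, b + 1) in
   the usual indexing from 1. *)

definition R_mat :: "nat \<Rightarrow> rat mat" where
  "R_mat m = mat m m (\<lambda>(a, b).
     if b = 0 then - h_coeff m (a + 1) else if b = a + 1 then 1 else 0)"

(* In B_odd and B_even the case distinction is needed because j - i is truncated subtraction:
   a binomial coefficient with negative lower entry is 0. *)

definition B_odd :: "nat \<Rightarrow> rat mat" where
  "B_odd m = mat m m (\<lambda>(a, b). let i = a + 1; j = b + 1 in
     if i \<le> j then (-1) ^ (i + j - 1) * of_nat ((2 * j - 1) choose (j - i)) else 0)"

definition B_even :: "nat \<Rightarrow> rat mat" where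
  "B_even m = mat m m (\<lambda>(a, b). let i = a + 1; j = b + 1 in
     if i \<le> j then (-1) ^ (i + j) * of_nat ((2 * j) choose (j - i)) else 0)"

(* The integer power of an m x m matrix, taken in the multiplicative monoid of the matrix ring.
   For negative exponents it is meaningful for invertible matrices only; see R_mat_Units. *)
definition mat_int_pow :: "nat \<Rightarrow> rat mat \<Rightarrow> int \<Rightarrow> rat mat" where
  "mat_int_pow m A r = A [^]\<^bsub>ring_mat TYPE(rat) m ()\<^esub> r"

(* The sequences are indexed by j = 1, ..., m; their r-th term is the entry (j, 1), in the usual
   indexing, of the matrix.  The lemmas row_F_seq and row_G_seq below read the whole rows. *)

definition F_seq :: "nat \<Rightarrow> nat \<Rightarrow> int \<Rightarrow> rat" where
  "F_seq m j r = (of_nat (2 * m + 1) \<cdot>\<^sub>m (B_odd m * mat_int_pow m (R_mat m) r)) $$ (j - 1, 0)"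

definition G_seq :: "nat \<Rightarrow> nat \<Rightarrow> int \<Rightarrow> rat" where
  "G_seq m j r = (of_nat (2 * m + 1) \<cdot>\<^sub>m (B_even m * mat_int_pow m (R_mat m) r)) $$ (j - 1, 0)"

lemma R_mat_carrier [simp]: "R_mat m \<in> carrier_mat m m"
  and B_odd_carrier [simp]: "B_odd m \<in> carrier_mat m m"
  and B_even_carrier [simp]: "B_even m \<in> carrier_mat m m"
  by (simp_all add: R_mat_def B_odd_def B_even_def)

lemma R_mat_Units:
  assumes "m \<ge> 1"
  shows "R_mat m \<in> Units (ring_mat TYPE(rat) m ())"
proof -
  define S :: "rat mat" where "S = mat m m (\<lambda>(a, b).
    if b = m - 1 then - h_coeff m a / h_coeff m m else if a = b + 1 then 1 else 0)"
  have S: "S \<in> carrier_mat m m" by (simp add: S_def)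
  have "(of_nat (2 * m + 1) :: rat) \<noteq> 0"
    unfolding of_nat_eq_0_iff by simp
  then have hm: "h_coeff m m \<noteq> 0"
    by (simp add: h_coeff_def flip: mult_2 del: of_nat_add of_nat_mult of_nat_Suc)
  have h0: "h_coeff m 0 = 1" by (simp add: h_coeff_def)
  have RS: "R_mat m * S = 1\<^sub>m m"
  proof (rule eq_matI)
    fix a b assume "a < dim_row (1\<^sub>m m :: rat mat)" "b < dim_col (1\<^sub>m m :: rat mat)"
    then have ab: "a < m" "b < m" by simp_all
    have "(R_mat m * S) $$ (a, b) = (\<Sum>c = 0..<m. R_mat m $$ (a, c) * S $$ (c, b))"
      using ab by (simp add: R_mat_def S_def scalar_prod_def)
    also have "\<dots> = (\<Sum>c = 0..<m. (if c = 0 then - h_coeff m (a + 1) * S $$ (0, b) else 0)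
        + (if c = a + 1 then S $$ (a + 1, b) else 0))"
      using ab by (intro sum.cong) (auto simp: R_mat_def)
    also have "\<dots> = - h_coeff m (a + 1) * S $$ (0, b) + (if a + 1 < m then S $$ (a + 1, b) else 0)"
      using ab by (simp add: sum.distrib)
    also have "\<dots> = 1\<^sub>m m $$ (a, b)"
    proof (cases "a + 1 < m")
      case True
      then show ?thesis using ab hm h0 by (auto simp: S_def field_simps)
    next
      case False
      then have "a + 1 = m" using ab by simp
      then show ?thesis using ab hm h0 by (auto simp: S_def field_simps)
    qed
    finally show "(R_mat m * S) $$ (a, b) = 1\<^sub>m m $$ (a, b)" .
  qed (simp_all add: R_mat_def S_def)
  moreover have "S * R_mat m = 1\<^sub>m m"
    by (rule mat_mult_left_right_inverse[OF R_mat_carrier S RS])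
  ultimately show ?thesis
    using S unfolding Units_def by (auto simp: ring_mat_simps)
qed

lemma (in monoid) Units_int_pow:
  fixes r s :: int
  assumes "x \<in> Units G"
  shows "x [^] r \<in> Units G" and "x [^] (r + s) = x [^] r \<otimes> x [^] s"
proof -
  interpret U: group "units_of G" by (rule units_group)
  have eq: "x [^]\<^bsub>units_of G\<^esub> t = x [^] t" for t :: int
  proof -
    have u: "x [^] n \<in> Units G" for n :: nat
      using U.nat_pow_closed[of x n] assms
      by (simp add: units_of_carrier nat_pow_def units_of_one units_of_mult)
    show ?thesis
      using u assms unfolding int_pow_def2
      by (simp add: nat_pow_def units_of_one units_of_mult units_of_inv)
  qed
  show "x [^] r \<in> Units G"
    using U.int_pow_closed[of x r] assms by (simp add: eq units_of_carrier)
  show "x [^] (r + s) = x [^] r \<otimes> x [^] s"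
    using U.int_pow_mult[of x r s] assms by (simp add: eq units_of_carrier units_of_mult)
qed

lemma
  assumes "m \<ge> 1"
  shows mat_int_pow_R_carrier: "mat_int_pow m (R_mat m) r \<in> carrier_mat m m"
    and mat_int_pow_R_add: "mat_int_pow m (R_mat m) (r + s) =
           mat_int_pow m (R_mat m) r * mat_int_pow m (R_mat m) s"
    and mat_int_pow_R_one: "mat_int_pow m (R_mat m) 1 = R_mat m"
proof -
  interpret ring "ring_mat TYPE(rat) m ()" by (rule ring_mat)
  note U = R_mat_Units[OF assms]
  show "mat_int_pow m (R_mat m) r \<in> carrier_mat m m"
    using Units_closed[OF Units_int_pow(1)[OF U, of r]]
    by (simp add: mat_int_pow_def ring_mat_simps)
  show "mat_int_pow m (R_mat m) (r + s) =
      mat_int_pow m (R_mat m) r * mat_int_pow m (R_mat m) s"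
    using Units_int_pow(2)[OF U, of r s] by (simp add: mat_int_pow_def ring_mat_simps)
  show "mat_int_pow m (R_mat m) 1 = R_mat m"
    by (simp add: mat_int_pow_def int_pow_def2 nat_pow_def ring_mat_simps
        left_mult_one_mat[OF R_mat_carrier])
qed

lemma mat_int_pow_R_shift:
  assumes "c < m" "a < m"
  shows "mat_int_pow m (R_mat m) r $$ (a, c) = mat_int_pow m (R_mat m) (r - int c) $$ (a, 0)"
  using assms(1)
proof (induction c arbitrary: r)
  case 0
  then show ?case by simp
next
  case (Suc c)
  let ?X = "mat_int_pow m (R_mat m) (r - 1)"
  have m: "m \<ge> 1" using Suc.prems by simp
  have X: "?X \<in> carrier_mat m m" by (rule mat_int_pow_R_carrier[OF m])
  have "mat_int_pow m (R_mat m) r = ?X * R_mat m"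
    using mat_int_pow_R_add[OF m, of "r - 1" 1] by (simp add: mat_int_pow_R_one[OF m])
  then have "mat_int_pow m (R_mat m) r $$ (a, Suc c)
      = (\<Sum>k = 0..<m. ?X $$ (a, k) * R_mat m $$ (k, Suc c))"
    using X Suc.prems assms(2) by (simp add: scalar_prod_def R_mat_def)
  also have "\<dots> = (\<Sum>k = 0..<m. if k = c then ?X $$ (a, k) else 0)"
    using Suc.prems by (intro sum.cong) (auto simp: R_mat_def)
  also have "\<dots> = ?X $$ (a, c)" using Suc.prems by simp
  also have "\<dots> = mat_int_pow m (R_mat m) (r - 1 - int c) $$ (a, 0)"
    using Suc.prems by (intro Suc.IH) simp
  finally show ?case by (simp add: algebra_simps)
qed

lemma row_mat_int_pow_R:
  assumes "1 \<le> j" "j \<le> m" "B \<in> carrier_mat m m"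
  shows "row (q \<cdot>\<^sub>m (B * mat_int_pow m (R_mat m) (int m + r))) (j - 1)
       = vec m (\<lambda>c. (q \<cdot>\<^sub>m (B * mat_int_pow m (R_mat m) (r + int m - int c))) $$ (j - 1, 0))"
proof (rule eq_vecI)
  have m: "m \<ge> 1" using assms by simp
  note C = mat_int_pow_R_carrier[OF m]
  have dims: "dim_row (mat_int_pow m (R_mat m) s) = m" "dim_col (mat_int_pow m (R_mat m) s) = m"
    for s using C[of s] by auto
  fix c assume "c < dim_vec (vec m (\<lambda>c. (q \<cdot>\<^sub>m (B * mat_int_pow m (R_mat m)
    (r + int m - int c))) $$ (j - 1, 0)))"
  then have c: "c < m" by simp
  have "col (mat_int_pow m (R_mat m) (int m + r)) c
      = col (mat_int_pow m (R_mat m) (r + int m - int c)) 0"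
    using c m mat_int_pow_R_shift[OF c, of _ "int m + r"]
    by (intro eq_vecI) (simp_all add: dims add.commute)
  then show "row (q \<cdot>\<^sub>m (B * mat_int_pow m (R_mat m) (int m + r))) (j - 1) $ c
      = vec m (\<lambda>c. (q \<cdot>\<^sub>m (B * mat_int_pow m (R_mat m) (r + int m - int c))) $$ (j - 1, 0)) $ c"
    using c assms by (simp add: dims)
next
  have "dim_col (mat_int_pow m (R_mat m) (int m + r)) = m"
    using mat_int_pow_R_carrier[of m "int m + r"] assms by (intro carrier_matD(2)) simp
  then show "dim_vec (row (q \<cdot>\<^sub>m (B * mat_int_pow m (R_mat m) (int m + r))) (j - 1))
      = dim_vec (vec m (\<lambda>c. (q \<cdot>\<^sub>m (B * mat_int_pow m (R_mat m)
          (r + int m - int c))) $$ (j - 1, 0)))"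
    by simp
qed

lemma row_F_seq:
  assumes "1 \<le> j" "j \<le> m"
  shows "row (of_nat (2 * m + 1) \<cdot>\<^sub>m (B_odd m * mat_int_pow m (R_mat m) (int m + r))) (j - 1)
       = vec m (\<lambda>c. F_seq m j (r + int m - int c))"
  unfolding F_seq_def by (rule row_mat_int_pow_R[OF assms B_odd_carrier])

lemma row_G_seq:
  assumes "1 \<le> j" "j \<le> m"
  shows "row (of_nat (2 * m + 1) \<cdot>\<^sub>m (B_even m * mat_int_pow m (R_mat m) (int m + r))) (j - 1)
       = vec m (\<lambda>c. G_seq m j (r + int m - int c))"
  unfolding G_seq_def by (rule row_mat_int_pow_R[OF assms B_even_carrier])

end

theory Submission
  imports Defs
begin

text \<open>
  Write \<open>S\<close> for the shift \<open>(S s)\<^sub>r = s\<^bsub>r-1\<^esub>\<close>, and let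
  \<open>F\<^sub>i, G\<^sub>i\<close> be the sequences given by the rows \<open>i\<close> of the two matrices \<open>B\<close>. Each of them is a
  fixed linear combination of the components \<open>u\<^sub>c(r)\<close> of the first column of \<open>R\<^sup>r\<close>.
  The whole theorem rests on two interlacing relations,
  \<open>F\<^bsub>i+1\<^esub> = F\<^sub>i + G\<^sub>i\<close> and \<open>G\<^bsub>i+1\<^esub> = G\<^sub>i + S F\<^bsub>i+1\<^esub>\<close>
  (\<open>odd_row_Suc\<close>, \<open>even_row_Suc\<close>).

  The first is Pascal's rule. For the second, Pascal's rule turns \<open>G\<^bsub>i+1\<^esub> - G\<^sub>i\<close> into a combination
  of the \<open>u\<^sub>c(r)\<close> whose coefficients are those of \<open>F\<^bsub>i+1\<^esub>\<close>, displaced by one. The companion shape of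
  \<open>R\<close> gives \<open>u\<^sub>c(r) = u\<^bsub>c+1\<^esub>(r-1) - h\<^sub>c u\<^sub>1(r-1)\<close>, which undoes the displacement and produces
  \<open>S F\<^bsub>i+1\<^esub>\<close>; the terms in \<open>u\<^sub>1\<close> cancel because the numbers \<open>h\<^sub>c\<close> are orthogonal to the
  coefficients (\<open>odd_coeff_h_coeff_orthogonal\<close>), an \<open>n\<close>-th difference of a polynomial of degree
  \<open>n - 1\<close>.

  The polynomials satisfy the same relations:
  \<open>\<Q>\<^bsub>j+1\<^esub> = \<Q>\<^sub>j + \<P>\<^bsub>j+1\<^esub>\<close> and \<open>\<P>\<^bsub>j+1\<^esub> = \<P>\<^sub>j + x \<Q>\<^sub>j\<close>, which are also the
  Fibonacci recurrence at \<open>x = 1\<close>. Starting from \<open>F\<^sub>m = -G\<^sub>m\<close> and descending, the rows are therefore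
  \<open>\<Q>\<^sub>j(S) F\<^sub>m\<close> and \<open>-\<P>\<^sub>j(S) F\<^sub>m\<close> (\<open>rows_from_last\<close>). Ascending from \<open>G\<^sub>0 = 2 F\<^sub>1\<close>, they are
  \<open>P\<^bsub>j-1\<^esub>(S) F\<^sub>1\<close> and \<open>(\<P>\<^sub>j + \<P>\<^bsub>j-1\<^esub>)(S) F\<^sub>1\<close> (\<open>rows_from_first\<close>), since
  \<open>P\<^sub>j = 2 \<Q>\<^sub>j - \<P>\<^sub>j\<close>.

  For the generating functions, \<open>F\<^sub>m = S u\<^sub>1\<close>, the sequence \<open>u\<^sub>1\<close> is annihilated by \<open>P\<^sub>m(S)\<close>, and
  \<open>u\<^sub>1(0) = 1\<close>, \<open>u\<^sub>1(-t) = 0\<close> for \<open>0 < t < m\<close>. These zeros make multiplication of power series by a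
  polynomial of degree below \<open>m\<close> agree with its action by shifts.
\<close>

section \<open>The coefficients and their orthogonality relation\<close>

text \<open>
  As a function of \<open>k\<close>, the last factor is a polynomial of degree \<open>q\<close>, so its \<open>n\<close>-th difference
  vanishes. By Pascal's rule one difference lowers \<open>q\<close> by one, hence the induction.
\<close>

lemma alternating_sum_choose_shift:
  fixes q n N :: nat
  assumes "q < n"
  shows "(\<Sum>k\<le>n. (-1) ^ k * of_nat (n choose k) * of_nat ((N + k) choose q)) = (0 :: rat)"
  using assms
proof (induction n arbitrary: q N)
  case 0
  then show ?case by simp
next
  case (Suc n)
  have "(\<Sum>k\<le>Suc n. (-1) ^ k * of_nat (Suc n choose k) * of_nat ((N + k) choose q))
      = (\<Sum>k\<le>Suc n. (-1) ^ k * of_nat (n choose k) * (of_nat ((N + k) choose q) :: rat))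
      + (\<Sum>k\<le>Suc n. if k = 0 then 0
           else (-1) ^ k * of_nat (n choose (k - 1)) * of_nat ((N + k) choose q))"
    unfolding sum.distrib[symmetric]
    by (intro sum.cong refl, case_tac x) (simp_all add: algebra_simps)
  also have "\<dots> = (\<Sum>k\<le>n. (-1) ^ k * of_nat (n choose k) * of_nat ((N + k) choose q))
      + (\<Sum>k\<le>n. (-1) ^ Suc k * of_nat (n choose k) * of_nat ((N + Suc k) choose q))"
    by (subst (2) sum.atMost_Suc_shift) simp
  also have "\<dots> = (\<Sum>k\<le>n. (-1) ^ k * of_nat (n choose k)
      * (of_nat ((N + k) choose q) - of_nat (Suc (N + k) choose q)))"
    unfolding sum.distrib[symmetric] by (intro sum.cong) (simp_all add: algebra_simps)
  also have "\<dots> = 0"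
  proof (cases q)
    case 0
    then show ?thesis by simp
  next
    case (Suc p)
    then have "(\<Sum>k\<le>n. (-1) ^ k * of_nat (n choose k)
        * (of_nat ((N + k) choose q) - of_nat (Suc (N + k) choose q)))
        = - (\<Sum>k\<le>n. (-1) ^ k * of_nat (n choose k) * (of_nat ((N + k) choose p) :: rat))"
      unfolding sum_negf[symmetric] by (intro sum.cong) simp_all
    then show ?thesis using Suc.IH[of p N] Suc.prems \<open>q = Suc p\<close> by simp
  qed
  finally show ?case .
qed

text \<open>
  The entries of the matrices \<open>B\<close>, in the usual indexing from 1 but with no bound on the indices:
  the row \<open>0\<close> and the column \<open>m + 1\<close> make the interlacing relations uniform up to the boundary.
  The exponent \<open>i + c + 1\<close> has the parity of \<open>i + c - 1\<close> and avoids truncated subtraction.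
\<close>

definition odd_coeff :: "nat \<Rightarrow> nat \<Rightarrow> rat" where
  "odd_coeff i c = (if i \<le> c then (-1) ^ (i + c + 1) * of_nat ((2 * c - 1) choose (c - i)) else 0)"

definition even_coeff :: "nat \<Rightarrow> nat \<Rightarrow> rat" where
  "even_coeff i c = (if i \<le> c then (-1) ^ (i + c) * of_nat ((2 * c) choose (c - i)) else 0)"

lemma odd_coeff_Suc:
  assumes "i \<ge> 1"
  shows "odd_coeff (Suc i) c = odd_coeff i c + even_coeff i c"
proof (cases "Suc i \<le> c")
  case True
  then have "2 * c = Suc (2 * c - 1)" "c - i = Suc (c - Suc i)" by simp_all
  then have "2 * c choose (c - i) = ((2 * c - 1) choose (c - Suc i)) + ((2 * c - 1) choose (c - i))"
    by (metis binomial_Suc_Suc)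
  then show ?thesis using True by (simp add: odd_coeff_def even_coeff_def algebra_simps)
next
  case False
  then show ?thesis by (auto simp: odd_coeff_def even_coeff_def)
qed

lemma even_coeff_diff:
  "even_coeff (Suc i) c - even_coeff i c = odd_coeff (Suc i) (Suc c)"
proof (cases "Suc i \<le> c")
  case True
  then have "Suc (2 * c) choose (c - i) = ((2 * c) choose (c - Suc i)) + ((2 * c) choose (c - i))"
    using binomial_Suc_Suc[of "2 * c" "c - Suc i"] by (simp add: Suc_diff_Suc)
  then show ?thesis using True
    by (simp add: odd_coeff_def even_coeff_def algebra_simps del: binomial_Suc_Suc)
next
  case False
  then show ?thesis by (auto simp: odd_coeff_def even_coeff_def not_le less_Suc_eq_le)
qed

lemma even_coeff_0:
  assumes "c \<ge> 1"
  shows "even_coeff 0 c = 2 * odd_coeff 1 c"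
proof -
  obtain d where d: "c = Suc d" using assms by (cases c) auto
  have "Suc (2 * d + 1) choose Suc d = 2 * ((2 * d + 1) choose d)"
    using binomial_symmetric[of d "2 * d + 1"] by simp
  then show ?thesis by (simp add: d odd_coeff_def even_coeff_def del: binomial_Suc_Suc)
qed

lemma of_nat_odd_neq_0: "(of_nat (2 * m + 1) :: rat) \<noteq> 0"
  unfolding of_nat_eq_0_iff by simp

text \<open>
  The factor \<open>2c + 1\<close> and the factorial of \<open>2c\<close> cancel; the quotient of the two factorials in \<open>m + c\<close>
  and \<open>c + i + 1\<close> that remains is a falling factorial in \<open>c\<close> of degree only \<open>m - i - 1\<close>.
\<close>

lemma odd_coeff_mult_h_coeff:
  assumes "i \<le> c" "c \<le> m"
  shows "odd_coeff (Suc i) (Suc c) * h_coeff m c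
    = (-1) ^ (i + c + 1) * fact (m + c) / (fact (c - i) * fact (c + i + 1) * fact (m - c))"
proof -
  have a: "of_nat (Suc (2 * c) choose (c - i))
      = (fact (2 * c + 1) / (fact (c - i) * fact (c + i + 1)) :: rat)"
    using assms by (subst binomial_fact) (simp_all add: algebra_simps)
  have b: "of_nat ((m + c) choose (2 * c)) = (fact (m + c) / (fact (2 * c) * fact (m - c)) :: rat)"
    using assms by (subst binomial_fact) (simp_all add: algebra_simps)
  have "odd_coeff (Suc i) (Suc c) * h_coeff m c = (-1) ^ (i + c + 1)
      * (fact (2 * c + 1) / (fact (c - i) * fact (c + i + 1)))
      * (1 / of_nat (2 * c + 1) * (fact (m + c) / (fact (2 * c) * fact (m - c))))"
    using assms unfolding odd_coeff_def h_coeff_def b a[symmetric]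
    by (simp del: binomial_Suc_Suc)
  also have "\<dots> = (-1) ^ (i + c + 1) * fact (m + c)
      / (fact (c - i) * fact (c + i + 1) * fact (m - c))"
  proof -
    have cancel: "s * ((n * y) / (u * v)) * (1 / n * (z / (y * w))) = s * z / (u * v * w)"
      if "n \<noteq> 0" "y \<noteq> 0" for s n y u v z w :: rat
      using that by simp
    have "(fact (2 * c + 1) :: rat) = of_nat (2 * c + 1) * fact (2 * c)"
      by (simp only: add.commute[of _ 1] fact_Suc plus_1_eq_Suc)
    then show ?thesis
      by (simp only: cancel[OF of_nat_odd_neq_0 fact_nonzero])
  qed
  finally show ?thesis .
qed

text \<open>
  With \<open>c = i + k\<close> and \<open>n = m - i\<close>, the sum is a multiple of an \<open>n\<close>-th difference of the binomial
  coefficient of \<open>m + i + k\<close> over \<open>n - 1\<close>.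
\<close>

lemma odd_coeff_h_coeff_orthogonal:
  assumes "i < m"
  shows "(\<Sum>c\<le>m. odd_coeff (Suc i) (Suc c) * h_coeff m c) = 0"
proof -
  define n where "n = m - i"
  have n: "m = n + i" "n \<ge> 1" using assms by (simp_all add: n_def)
  have "(\<Sum>c\<le>m. odd_coeff (Suc i) (Suc c) * h_coeff m c)
      = (\<Sum>c = i..n + i. odd_coeff (Suc i) (Suc c) * h_coeff m c)"
    unfolding n by (intro sum.mono_neutral_right) (auto simp: odd_coeff_def)
  also have "\<dots> = (\<Sum>k = 0..n. odd_coeff (Suc i) (Suc (k + i)) * h_coeff m (k + i))"
    using sum.shift_bounds_cl_nat_ivl[of "\<lambda>c. odd_coeff (Suc i) (Suc c) * h_coeff m c" 0 i n]
    by simp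
  also have "\<dots> = (\<Sum>k\<le>n. - fact (n - 1) / fact n
      * ((-1) ^ k * of_nat (n choose k) * of_nat ((m + i + k) choose (n - 1))))"
    unfolding atLeast0AtMost
  proof (rule sum.cong[OF refl])
    fix k assume "k \<in> {..n}"
    then have k: "k \<le> n" by simp
    have s: "(-1) ^ (i + (k + i) + 1) = - ((-1) ^ k :: rat)"
      by (simp add: power_add flip: power_mult_distrib)
    have e: "m + (k + i) = m + i + k" "k + i - i = k" "k + i + i + 1 = 2 * i + k + 1"
      "m - (k + i) = n - k"
      by (simp_all add: n(1))
    have b1: "of_nat (n choose k) = (fact n / (fact k * fact (n - k)) :: rat)"
      by (rule binomial_fact[OF k])
    have "m + i + k - (n - 1) = 2 * i + k + 1" using n by simp
    then have b2: "of_nat ((m + i + k) choose (n - 1))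
        = (fact (m + i + k) / (fact (n - 1) * fact (2 * i + k + 1)) :: rat)"
      using n(1) by (subst binomial_fact) (simp_all del: fact_Suc)
    have cancel: "- (s * z / (x * y * w)) = - p / q * (s * (q / (x * w)) * (z / (p * y)))"
      if "p \<noteq> 0" "q \<noteq> 0" for s z x y w p q :: rat
      using that by simp
    have "odd_coeff (Suc i) (Suc (k + i)) * h_coeff m (k + i)
      = (-1) ^ (i + (k + i) + 1) * fact (m + (k + i))
        / (fact (k + i - i) * fact (k + i + i + 1) * fact (m - (k + i)))"
      by (rule odd_coeff_mult_h_coeff) (use k n in auto)
    also have "\<dots> = - ((-1) ^ k * fact (m + i + k)
        / (fact k * fact (2 * i + k + 1) * fact (n - k)))"
      unfolding s e by (simp del: fact_Suc)
    also have "\<dots> = - fact (n - 1) / fact n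
      * ((-1) ^ k * of_nat (n choose k) * of_nat ((m + i + k) choose (n - 1)))"
      unfolding b1 b2 by (rule cancel) simp_all
    finally show "odd_coeff (Suc i) (Suc (k + i)) * h_coeff m (k + i) = \<dots>" .
  qed
  also have "\<dots> = 0"
    unfolding sum_distrib_left[symmetric]
    using alternating_sum_choose_shift[of "n - 1" n "m + i"] n(2) by simp
  finally show ?thesis .
qed

section \<open>The first columns of the powers of the matrix\<close>

text \<open>
  The component \<open>c\<close>, counted from 1, of the first column of the \<open>r\<close>-th power. The value \<open>0\<close> outside
  \<open>1..m\<close> is what the recurrence \<open>R_col_step\<close> demands at \<open>c = 0\<close> (where \<open>h\<^sub>0 = 1\<close>) and \<open>c = m\<close>.
\<close>

definition R_col :: "nat \<Rightarrow> nat \<Rightarrow> int \<Rightarrow> rat" where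
  "R_col m c r = (if 1 \<le> c \<and> c \<le> m then mat_int_pow m (R_mat m) r $$ (c - 1, 0) else 0)"

lemma h_coeff_0 [simp]: "h_coeff m 0 = 1"
  by (simp add: h_coeff_def)

text \<open>The first column of \<open>R\<^sup>r = R R\<^bsup>r-1\<^esup>\<close>.\<close>

lemma R_col_step:
  assumes "m \<ge> 1" "c \<le> m"
  shows "R_col m c r = R_col m (Suc c) (r - 1) - h_coeff m c * R_col m 1 (r - 1)"
proof (cases c)
  case 0
  then show ?thesis using assms by (simp add: R_col_def)
next
  case (Suc a)
  let ?X = "mat_int_pow m (R_mat m) (r - 1)"
  have X: "?X \<in> carrier_mat m m" by (rule mat_int_pow_R_carrier[OF assms(1)])
  have "mat_int_pow m (R_mat m) r = R_mat m * ?X"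
    using mat_int_pow_R_add[OF assms(1), of 1 "r - 1"]
    by (simp add: mat_int_pow_R_one[OF assms(1)])
  then have "mat_int_pow m (R_mat m) r $$ (a, 0)
      = (\<Sum>k = 0..<m. R_mat m $$ (a, k) * ?X $$ (k, 0))"
    using X assms Suc by (simp add: scalar_prod_def R_mat_def)
  also have "\<dots> = (\<Sum>k = 0..<m. (if k = 0 then - h_coeff m (a + 1) * ?X $$ (0, 0) else 0)
        + (if k = a + 1 then ?X $$ (a + 1, 0) else 0))"
    using assms Suc by (intro sum.cong) (auto simp: R_mat_def)
  also have "\<dots> = - h_coeff m (a + 1) * ?X $$ (0, 0)
      + (if a + 1 < m then ?X $$ (a + 1, 0) else 0)"
    using assms by (simp add: sum.distrib)
  finally show ?thesis using assms Suc by (auto simp: R_col_def)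
qed

text \<open>
  The entry in the upper left corner of \<open>R\<^sup>r = R\<^bsup>r-1\<^esup> R\<close>: the columns of \<open>R\<^bsup>r-1\<^esup>\<close> are first
  columns of lower powers, and the first column of \<open>R\<close> holds the numbers \<open>-h\<^sub>k\<close>.
\<close>

lemma R_col_1_recurrence:
  assumes "m \<ge> 1"
  shows "(\<Sum>k\<le>m. h_coeff m k * R_col m 1 (r - int k)) = 0"
proof -
  let ?X = "mat_int_pow m (R_mat m) (r - 1)"
  have X: "?X \<in> carrier_mat m m" by (rule mat_int_pow_R_carrier[OF assms])
  have "mat_int_pow m (R_mat m) r = ?X * R_mat m"
    using mat_int_pow_R_add[OF assms, of "r - 1" 1] by (simp add: mat_int_pow_R_one[OF assms])
  then have "R_col m 1 r = (\<Sum>k = 0..<m. ?X $$ (0, k) * R_mat m $$ (k, 0))"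
    using X assms by (simp add: R_col_def scalar_prod_def R_mat_def)
  also have "\<dots> = (\<Sum>k<m. - (h_coeff m (Suc k) * R_col m 1 (r - int (Suc k))))"
    unfolding atLeast0LessThan
  proof (rule sum.cong[OF refl])
    fix k assume "k \<in> {..<m}"
    moreover from this have R_k: "R_mat m $$ (k, 0) = - h_coeff m (Suc k)"
      by (simp add: R_mat_def)
    ultimately show "?X $$ (0, k) * R_mat m $$ (k, 0)
        = - (h_coeff m (Suc k) * R_col m 1 (r - int (Suc k)))"
      using mat_int_pow_R_shift[of k m 0 "r - 1"] R_k
      by (simp add: R_col_def diff_diff_eq)
  qed
  finally show ?thesis
    unfolding lessThan_Suc_atMost[symmetric] sum.lessThan_Suc_shift
    by (simp add: sum_negf)
qed

text \<open>The first row of \<open>R\<^sup>0 = 1\<close>, whose columns are the first columns of \<open>1, R\<^bsup>-1\<^esup>, R\<^bsup>-2\<^esup>, \<dots>\<close>.\<close>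

lemma R_col_1_initial:
  assumes "t < m"
  shows "R_col m 1 (- int t) = (if t = 0 then 1 else 0)"
proof -
  have "mat_int_pow m (R_mat m) 0 = 1\<^sub>m m"
    by (simp add: mat_int_pow_def int_pow_def2 nat_pow_def ring_mat_simps)
  then show ?thesis
    using mat_int_pow_R_shift[of t m 0 0] assms by (simp add: R_col_def)
qed

section \<open>The interlacing relations\<close>

text \<open>
  The sequences of the theorem, extended to all row indices: the row \<open>0\<close> is the starting
  point of the expansion in terms of the first sequence.
\<close>

definition odd_row :: "nat \<Rightarrow> nat \<Rightarrow> int \<Rightarrow> rat" where
  "odd_row m i r = of_nat (2 * m + 1) * (\<Sum>c\<le>m. odd_coeff i c * R_col m c r)"

definition even_row :: "nat \<Rightarrow> nat \<Rightarrow> int \<Rightarrow> rat" where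
  "even_row m i r = of_nat (2 * m + 1) * (\<Sum>c\<le>m. even_coeff i c * R_col m c r)"

lemma sum_R_col_reindex:
  "(\<Sum>b = 0..<m. x (Suc b) * mat_int_pow m (R_mat m) r $$ (b, 0))
    = (\<Sum>c\<le>m. x c * R_col m c r)"
  unfolding lessThan_Suc_atMost[symmetric] sum.lessThan_Suc_shift atLeast0LessThan
  by (simp add: R_col_def Suc_le_eq)

lemma
  assumes "1 \<le> j" "j \<le> m"
  shows F_seq_eq_odd_row: "F_seq m j r = odd_row m j r"
    and G_seq_eq_even_row: "G_seq m j r = even_row m j r"
proof -
  have m: "m \<ge> 1" using assms by simp
  let ?X = "mat_int_pow m (R_mat m) r"
  have X: "dim_row ?X = m" "dim_col ?X = m"
    using mat_int_pow_R_carrier[OF m, of r] by auto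
  have "F_seq m j r = of_nat (2 * m + 1) * (\<Sum>b = 0..<m. B_odd m $$ (j - 1, b) * ?X $$ (b, 0))"
    using assms X carrier_matD[OF B_odd_carrier[of m]]
    by (simp add: F_seq_def scalar_prod_def)
  also have "(\<Sum>b = 0..<m. B_odd m $$ (j - 1, b) * ?X $$ (b, 0))
      = (\<Sum>b = 0..<m. odd_coeff j (Suc b) * ?X $$ (b, 0))"
    using assms by (intro sum.cong) (auto simp: B_odd_def odd_coeff_def Let_def)
  finally show "F_seq m j r = odd_row m j r"
    unfolding sum_R_col_reindex odd_row_def .
  have "G_seq m j r = of_nat (2 * m + 1) * (\<Sum>b = 0..<m. B_even m $$ (j - 1, b) * ?X $$ (b, 0))"
    using assms X carrier_matD[OF B_even_carrier[of m]]
    by (simp add: G_seq_def scalar_prod_def)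
  also have "(\<Sum>b = 0..<m. B_even m $$ (j - 1, b) * ?X $$ (b, 0))
      = (\<Sum>b = 0..<m. even_coeff j (Suc b) * ?X $$ (b, 0))"
    using assms by (intro sum.cong) (auto simp: B_even_def even_coeff_def Let_def)
  finally show "G_seq m j r = even_row m j r"
    unfolding sum_R_col_reindex even_row_def .
qed

lemma odd_row_Suc:
  assumes "i \<ge> 1"
  shows "odd_row m (Suc i) r = odd_row m i r + even_row m i r"
  by (simp only: odd_row_def even_row_def odd_coeff_Suc[OF assms] distrib_left distrib_right
      sum.distrib)

lemma even_row_Suc:
  assumes "i < m"
  shows "even_row m (Suc i) r = even_row m i r + odd_row m (Suc i) (r - 1)"
proof -
  have m: "m \<ge> 1" using assms by simp
  have "(\<Sum>c\<le>m. even_coeff (Suc i) c * R_col m c r) - (\<Sum>c\<le>m. even_coeff i c * R_col m c r)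
      = (\<Sum>c\<le>m. odd_coeff (Suc i) (Suc c) * R_col m c r)"
    unfolding even_coeff_diff[symmetric] by (simp add: left_diff_distrib sum_subtractf)
  also have "\<dots> = (\<Sum>c\<le>m. odd_coeff (Suc i) (Suc c) * R_col m (Suc c) (r - 1)
      - odd_coeff (Suc i) (Suc c) * h_coeff m c * R_col m 1 (r - 1))"
    by (intro sum.cong refl) (simp add: R_col_step[OF m] algebra_simps)
  also have "\<dots> = (\<Sum>c\<le>m. odd_coeff (Suc i) (Suc c) * R_col m (Suc c) (r - 1))"
    by (simp add: sum_subtractf odd_coeff_h_coeff_orthogonal[OF assms]
        flip: sum_distrib_right)
  \<comment> \<open>The index moves by one freely, since the components \<open>0\<close> and \<open>m + 1\<close> vanish.\<close>
  also have "\<dots> = (\<Sum>c\<le>Suc m. odd_coeff (Suc i) c * R_col m c (r - 1))"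
    by (subst sum.atMost_Suc_shift) (simp add: R_col_def)
  also have "\<dots> = (\<Sum>c\<le>m. odd_coeff (Suc i) c * R_col m c (r - 1))"
    by (simp add: R_col_def)
  finally have "(\<Sum>c\<le>m. even_coeff (Suc i) c * R_col m c r)
      = (\<Sum>c\<le>m. even_coeff i c * R_col m c r) + (\<Sum>c\<le>m. odd_coeff (Suc i) c * R_col m c (r - 1))"
    by (simp only: diff_eq_eq add.commute)
  then show ?thesis by (simp only: even_row_def odd_row_def distrib_left)
qed

lemma even_row_0: "even_row m 0 r = 2 * odd_row m 1 r"
proof -
  have e: "even_coeff 0 c * R_col m c r = 2 * (odd_coeff 1 c * R_col m c r)" for c
  proof (cases "c = 0")
    case True
    then show ?thesis by (simp add: R_col_def)
  next
    case False
    then have "even_coeff 0 c = 2 * odd_coeff 1 c" by (intro even_coeff_0) simp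
    then show ?thesis by (simp only: mult.assoc)
  qed
  show ?thesis
    unfolding even_row_def odd_row_def e sum_distrib_left[symmetric] by (rule mult.left_commute)
qed

lemma
  shows odd_row_last: "odd_row m m r = - (of_nat (2 * m + 1) * R_col m m r)"
    and even_row_last: "even_row m m r = of_nat (2 * m + 1) * R_col m m r"
proof -
  have "(\<Sum>c\<le>m. odd_coeff m c * R_col m c r) = (\<Sum>c\<in>{m}. odd_coeff m c * R_col m c r)"
    by (intro sum.mono_neutral_right) (auto simp: odd_coeff_def)
  then show "odd_row m m r = - (of_nat (2 * m + 1) * R_col m m r)"
    by (simp add: odd_row_def odd_coeff_def del: of_nat_add of_nat_mult of_nat_Suc)
  have "(\<Sum>c\<le>m. even_coeff m c * R_col m c r) = (\<Sum>c\<in>{m}. even_coeff m c * R_col m c r)"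
    by (intro sum.mono_neutral_right) (auto simp: even_coeff_def)
  then show "even_row m m r = of_nat (2 * m + 1) * R_col m m r"
    by (simp add: even_row_def even_coeff_def)
qed

text \<open>
  The last component of the first column of \<open>R\<^sup>r\<close> is \<open>-h\<^sub>m u\<^sub>1(r-1)\<close>, and \<open>(2m + 1) h\<^sub>m = 1\<close>, which
  absorbs the normalising factor of the rows.
\<close>

lemma odd_row_last_eq_R_col_1:
  assumes "m \<ge> 1"
  shows "odd_row m m r = R_col m 1 (r - 1)"
proof -
  have "R_col m m r = - h_coeff m m * R_col m 1 (r - 1)"
    using R_col_step[OF assms, of m r] by (simp add: R_col_def[of m "Suc m"])
  moreover have "of_nat (2 * m + 1) * h_coeff m m = 1"
    using of_nat_odd_neq_0[of m]
    by (simp add: h_coeff_def flip: mult_2 del: of_nat_add of_nat_mult of_nat_Suc)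
  ultimately show ?thesis
    unfolding odd_row_last
    by (simp only: mult_minus_left mult_minus_right minus_minus mult_1_left flip: mult.assoc)
qed

section \<open>Polynomials acting on sequences by shifts\<close>

definition shift_act :: "'a::comm_ring_1 poly \<Rightarrow> (int \<Rightarrow> 'a) \<Rightarrow> int \<Rightarrow> 'a" where
  "shift_act p s r = (\<Sum>k\<le>degree p. coeff p k * s (r - int k))"

lemma shift_act_eq:
  assumes "degree p \<le> n"
  shows "shift_act p s r = (\<Sum>k\<le>n. coeff p k * s (r - int k))"
  unfolding shift_act_def using assms
  by (intro sum.mono_neutral_left) (auto simp: coeff_eq_0)

lemma shift_act_add: "shift_act (p + q) s r = shift_act p s r + shift_act q s r"
proof -
  let ?n = "max (degree p) (degree q)"
  show ?thesis
    by (simp add: shift_act_eq[of _ ?n] degree_add_le_max distrib_right sum.distrib)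
qed

lemma shift_act_pCons: "shift_act (pCons a p) s r = a * s r + shift_act p s (r - 1)"
proof -
  have "shift_act (pCons a p) s r = (\<Sum>k\<le>Suc (degree p). coeff (pCons a p) k * s (r - int k))"
    by (rule shift_act_eq) (rule degree_pCons_le)
  then show ?thesis
    by (simp only: sum.atMost_Suc_shift) (simp add: shift_act_def algebra_simps)
qed

lemma shift_act_1: "shift_act 1 s r = s r"
  by (simp add: shift_act_def)

text \<open>
  The product of series stops at \<open>k = r\<close>, the action by shifts goes on to the degree of \<open>p\<close>; the hypothesis
  removes the difference.
\<close>

lemma fps_nth_poly_mult_eq_shift_act:
  fixes s :: "int \<Rightarrow> 'a::comm_ring_1"
  assumes "\<And>k. r < k \<Longrightarrow> k \<le> degree p \<Longrightarrow> s (int r - int k) = 0"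
  shows "fps_nth (fps_of_poly p * Abs_fps (\<lambda>n. s (int n))) r = shift_act p s (int r)"
proof -
  have "fps_nth (fps_of_poly p * Abs_fps (\<lambda>n. s (int n))) r
      = (\<Sum>k = 0..r. coeff p k * s (int r - int k))"
    by (simp add: fps_mult_nth of_nat_diff)
  also have "\<dots> = (\<Sum>k\<le>max r (degree p). coeff p k * s (int r - int k))"
    using assms by (intro sum.mono_neutral_left) (auto simp: not_le)
  also have "\<dots> = shift_act p s (int r)" by (rule shift_act_eq[symmetric]) simp
  finally show ?thesis .
qed

section \<open>Recurrences of the three families of polynomials\<close>

lemma coeff_sum_monom:
  assumes "\<And>k. k > n \<Longrightarrow> c k = 0"
  shows "coeff (\<Sum>k\<le>n. monom (c k) k) i = c i"
  using assms by (simp add: coeff_sum not_le)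

lemma coeff_calP_poly [simp]: "coeff (calP_poly j) k = of_nat ((j + k) choose (2 * k))"
  unfolding calP_poly_def by (rule coeff_sum_monom) simp

lemma coeff_calQ_poly [simp]: "coeff (calQ_poly j) k = of_nat ((j + k + 1) choose (2 * k + 1))"
  unfolding calQ_poly_def by (rule coeff_sum_monom) (simp del: binomial_Suc_Suc)

lemma coeff_P_poly:
  "coeff (P_poly j) k = of_nat (2 * j + 1) / of_nat (2 * k + 1) * of_nat ((j + k) choose (2 * k))"
  unfolding P_poly_def by (rule coeff_sum_monom) simp

lemma coeff_P_poly_h: "coeff (P_poly j) k = of_nat (2 * j + 1) * h_coeff j k"
  by (simp add: coeff_P_poly h_coeff_def)

lemma
  shows degree_calP_poly: "degree (calP_poly j) \<le> j"
    and degree_calQ_poly: "degree (calQ_poly j) \<le> j"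
    and degree_P_poly: "degree (P_poly j) \<le> j"
  by (rule degree_le, simp add: coeff_P_poly del: binomial_Suc_Suc)+

lemma calP_poly_0 [simp]: "calP_poly 0 = 1"
  and calQ_poly_0 [simp]: "calQ_poly 0 = 1"
  and P_poly_0 [simp]: "P_poly 0 = 1"
  by (simp_all add: calP_poly_def calQ_poly_def P_poly_def monom_0 one_pCons)

lemma calQ_poly_Suc: "calQ_poly (Suc j) = calQ_poly j + calP_poly (Suc j)"
  by (rule poly_eqI) (simp add: algebra_simps)

lemma calP_poly_Suc: "calP_poly (Suc j) = calP_poly j + pCons 0 (calQ_poly j)"
proof (rule poly_eqI)
  fix k show "coeff (calP_poly (Suc j)) k = coeff (calP_poly j + pCons 0 (calQ_poly j)) k"
    by (cases k) (simp_all add: coeff_pCons algebra_simps)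
qed

text \<open>
  This reduces the recurrences for \<open>P\<^sub>j\<close> to those for \<open>\<P>\<^sub>j\<close> and \<open>\<Q>\<^sub>j\<close>. On coefficients it says
  \<open>2j + 1 = 2(j + k + 1) - (2k + 1)\<close>, by the absorption identity for binomial coefficients.
\<close>

lemma P_poly_eq: "P_poly j = calQ_poly j + calQ_poly j - calP_poly j"
proof (rule poly_eqI)
  fix k
  have "Suc (2 * k) * ((j + k + 1) choose Suc (2 * k)) = (j + k + 1) * ((j + k) choose (2 * k))"
    using Suc_times_binomial[of "2 * k" "j + k"] by simp
  then have "of_nat (Suc (2 * k)) * of_nat ((j + k + 1) choose Suc (2 * k))
      = (of_nat (j + k + 1) * of_nat ((j + k) choose (2 * k)) :: rat)"
    by (metis of_nat_mult)
  then have q: "of_nat ((j + k + 1) choose (2 * k + 1))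
      = (of_nat (j + k + 1) * of_nat ((j + k) choose (2 * k)) / of_nat (2 * k + 1) :: rat)"
    using of_nat_odd_neq_0[of k]
    by (simp add: eq_divide_eq mult.commute del: binomial_Suc_Suc of_nat_Suc)
  have "of_nat (2 * j + 1) = (2 * of_nat (j + k + 1) - of_nat (2 * k + 1) :: rat)"
    by simp
  then show "coeff (P_poly j) k = coeff (calQ_poly j + calQ_poly j - calP_poly j) k"
    using of_nat_odd_neq_0[of k]
    by (simp only: coeff_P_poly coeff_add coeff_diff coeff_calP_poly coeff_calQ_poly q)
      (simp add: divide_simps, simp add: algebra_simps)
qed

text \<open>
  The polynomials \<open>P\<^sub>i\<close> and \<open>\<P>\<^bsub>i+1\<^esub> + \<P>\<^sub>i\<close> thus obey the interlacing relations of the odd and even rows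
  \<open>i + 1\<close>.
\<close>

lemma P_poly_Suc: "P_poly (Suc i) = P_poly i + (calP_poly (Suc i) + calP_poly i)"
  by (simp add: P_poly_eq calQ_poly_Suc)

lemma calP_poly_pair_Suc:
  "calP_poly (Suc (Suc i)) + calP_poly (Suc i)
    = (calP_poly (Suc i) + calP_poly i) + pCons 0 (P_poly (Suc i))"
proof -
  have "P_poly (Suc i) = calQ_poly (Suc i) + calQ_poly i"
    by (simp add: P_poly_eq calQ_poly_Suc)
  then show ?thesis by (simp add: calP_poly_Suc)
qed

text \<open>
  Absorption again, now through \<open>2j = 2(j + k) - 2k\<close>. At \<open>k = 0\<close> the coefficient is \<open>2\<close>, which the formula
  does not cover; this is why the expansion of the even sequences has its first term apart.
\<close>

lemma coeff_calP_poly_pair: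
  assumes "j \<ge> 1" "k \<ge> 1"
  shows "coeff (calP_poly j + calP_poly (j - 1)) k
    = of_nat j / of_nat k * of_nat ((j + k - 1) choose (2 * k - 1))"
proof -
  obtain a b where ab: "j = Suc a" "k = Suc b" using assms by (metis Suc_le_D One_nat_def)
  define n where "n = a + b + 1"
  let ?x = "of_nat (n choose (2 * b + 1)) :: rat"
  have "Suc (2 * b + 1) * (Suc n choose Suc (2 * b + 1)) = Suc n * (n choose (2 * b + 1))"
    by (rule Suc_times_binomial)
  then have "of_nat (Suc (2 * b + 1)) * of_nat (Suc n choose Suc (2 * b + 1))
      = (of_nat (Suc n) * ?x :: rat)"
    by (metis of_nat_mult)
  then have e: "of_nat (Suc n choose (2 * b + 2)) = of_nat (a + b + 2) * ?x / of_nat (2 * b + 2)"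
    by (simp add: n_def field_simps del: binomial_Suc_Suc)
  have "Suc n choose (2 * b + 2) = (n choose (2 * b + 1)) + (n choose (2 * b + 2))"
    by simp
  then have f: "of_nat (n choose (2 * b + 2)) = of_nat (Suc n choose (2 * b + 2)) - ?x"
    by simp
  have "coeff (calP_poly j + calP_poly (j - 1)) k
      = of_nat (Suc n choose (2 * b + 2)) + of_nat (n choose (2 * b + 2))"
    by (simp add: ab n_def del: binomial_Suc_Suc)
  also have "\<dots> = of_nat (Suc a) / of_nat (Suc b) * ?x"
  proof -
    have n0: "of_nat (2 * b + 2) \<noteq> (0 :: rat)" unfolding of_nat_eq_0_iff by simp
    have "of_nat (Suc n choose (2 * b + 2)) + of_nat (n choose (2 * b + 2))
        = (2 * of_nat (a + b + 2) - of_nat (2 * b + 2)) * ?x / of_nat (2 * b + 2)"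
      unfolding f e using n0 by (simp only: diff_divide_distrib left_diff_distrib) simp
    also have "2 * of_nat (a + b + 2) - of_nat (2 * b + 2) = (2 * of_nat (Suc a) :: rat)" by simp
    also have "of_nat (2 * b + 2) = (2 * of_nat (Suc b) :: rat)" by simp
    finally show ?thesis by (simp only: mult.assoc mult_divide_mult_cancel_left_if) simp
  qed
  finally show ?thesis by (simp add: ab n_def)
qed

lemma poly_1_fib:
  "poly (calP_poly j) 1 = of_nat (fib (2 * j + 1)) \<and> poly (calQ_poly j) 1 = of_nat (fib (2 * j + 2))"
  by (induction j) (simp_all add: calP_poly_Suc calQ_poly_Suc)

section \<open>Expansions and generating functions\<close>

text \<open>
  Read downwards, the relations \<open>F\<^sub>i = F\<^bsub>i+1\<^esub> - G\<^sub>i\<close> and \<open>-G\<^sub>i = -G\<^bsub>i+1\<^esub> + S F\<^bsub>i+1\<^esub>\<close> are the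
  recurrences of \<open>\<Q>\<^sub>j\<close> and \<open>\<P>\<^sub>j\<close> with \<open>j = m - i\<close>.
\<close>

lemma rows_from_last:
  assumes "m \<ge> 1" "j \<le> m - 1"
  shows "odd_row m (m - j) r = shift_act (calQ_poly j) (odd_row m m) r
       \<and> even_row m (m - j) r = - shift_act (calP_poly j) (odd_row m m) r"
  using assms(2)
proof (induction j arbitrary: r)
  case 0
  then show ?case by (simp add: shift_act_1 odd_row_last even_row_last)
next
  case (Suc j)
  define i where "i = m - Suc j"
  have i: "i \<ge> 1" "i < m" "m - j = Suc i" using Suc.prems assms(1) by (auto simp: i_def)
  note IH = Suc.IH[unfolded i(3)]
  have G: "even_row m i r = - shift_act (calP_poly (Suc j)) (odd_row m m) r"
    using even_row_Suc[OF i(2), of r] IH[of r] IH[of "r - 1"] Suc.prems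
    by (simp add: calP_poly_Suc shift_act_add shift_act_pCons)
  moreover have "odd_row m i r = shift_act (calQ_poly (Suc j)) (odd_row m m) r"
    using odd_row_Suc[OF i(1), of m r] IH[of r] G Suc.prems
    by (simp add: calQ_poly_Suc shift_act_add)
  ultimately show ?case by (simp add: i_def)
qed

lemma rows_from_first:
  assumes "i < m"
  shows "odd_row m (Suc i) r = shift_act (P_poly i) (odd_row m 1) r
       \<and> even_row m (Suc i) r = shift_act (calP_poly (Suc i) + calP_poly i) (odd_row m 1) r"
  using assms
proof (induction i arbitrary: r)
  case 0
  have p: "calP_poly (Suc 0) + calP_poly 0 = (1 + pCons 0 1) + 1"
    by (simp only: calP_poly_Suc calP_poly_0 calQ_poly_0)
  have "shift_act (calP_poly (Suc 0) + calP_poly 0) (odd_row m 1) r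
      = 2 * odd_row m 1 r + odd_row m 1 (r - 1)"
    unfolding p shift_act_add shift_act_pCons shift_act_1 by simp
  then show ?case
    using even_row_Suc[OF 0, of r] even_row_0[of m r] by (simp add: shift_act_1 del: calP_poly_0)
next
  case (Suc i)
  have F: "odd_row m (Suc (Suc i)) r = shift_act (P_poly (Suc i)) (odd_row m 1) r" for r
    using odd_row_Suc[of "Suc i" m r] Suc by (simp add: P_poly_Suc shift_act_add)
  have "even_row m (Suc (Suc i)) r
      = shift_act (calP_poly (Suc i) + calP_poly i) (odd_row m 1) r
        + shift_act (P_poly (Suc i)) (odd_row m 1) (r - 1)"
    using even_row_Suc[of "Suc i" m r] Suc F by simp
  also have "\<dots> = shift_act (calP_poly (Suc (Suc i)) + calP_poly (Suc i)) (odd_row m 1) r"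
    by (simp only: calP_poly_pair_Suc shift_act_add shift_act_pCons mult_zero_left add_0)
  finally show ?case using F by simp
qed

text \<open>
  The initial values allow \<open>P\<^sub>m\<close> to act by shifts in every coefficient but the one of \<open>x\<^sup>0\<close>, where
  \<open>u\<^sub>1(-m)\<close> would enter; that coefficient is \<open>(2m + 1) u\<^sub>1(0)\<close>.
\<close>

lemma R_col_1_gen_fun:
  assumes "m \<ge> 1"
  shows "fps_of_poly (P_poly m) * Abs_fps (\<lambda>n. R_col m 1 (int n)) = of_nat (2 * m + 1)"
proof (rule fps_ext)
  fix r
  show "fps_nth (fps_of_poly (P_poly m) * Abs_fps (\<lambda>n. R_col m 1 (int n))) r
      = fps_nth (of_nat (2 * m + 1)) r"
  proof (cases "r = 0")
    case True
    then show ?thesis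
      using R_col_1_initial[of 0 m] assms by (simp add: coeff_P_poly fps_of_nat[symmetric])
  next
    case False
    have "fps_nth (fps_of_poly (P_poly m) * Abs_fps (\<lambda>n. R_col m 1 (int n))) r
        = shift_act (P_poly m) (R_col m 1) (int r)"
    proof (rule fps_nth_poly_mult_eq_shift_act)
      fix k assume "r < k" "k \<le> degree (P_poly m)"
      then have "int r - int k = - int (k - r)" "k - r < m" "k - r \<noteq> 0"
        using False degree_P_poly[of m] by auto
      then show "R_col m 1 (int r - int k) = 0" by (simp only: R_col_1_initial) simp
    qed
    also have "\<dots> = (\<Sum>k\<le>m. coeff (P_poly m) k * R_col m 1 (int r - int k))"
      by (rule shift_act_eq[OF degree_P_poly])
    also have "\<dots> = of_nat (2 * m + 1) * (\<Sum>k\<le>m. h_coeff m k * R_col m 1 (int r - int k))"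
      by (simp only: coeff_P_poly_h sum_distrib_left mult.assoc)
    also have "\<dots> = 0" using R_col_1_recurrence[OF assms] by simp
    finally show ?thesis using False by (simp add: fps_of_nat[symmetric])
  qed
qed

lemma gen_fun_shift_act:
  assumes "m \<ge> 1" "degree p \<le> m - 1"
  shows "Abs_fps (\<lambda>r. shift_act p (odd_row m m) (int r + 1))
    = of_nat (2 * m + 1) * fps_of_poly p / fps_of_poly (P_poly m)"
proof -
  let ?A = "Abs_fps (\<lambda>n. R_col m 1 (int n))"
  have "Abs_fps (\<lambda>r. shift_act p (odd_row m m) (int r + 1)) = fps_of_poly p * ?A"
  proof (rule fps_ext)
    fix r
    have "fps_nth (fps_of_poly p * ?A) r = shift_act p (R_col m 1) (int r)"
    proof (rule fps_nth_poly_mult_eq_shift_act)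
      fix k assume "r < k" "k \<le> degree p"
      then have "int r - int k = - int (k - r)" "k - r < m" "k - r \<noteq> 0"
        using assms by auto
      then show "R_col m 1 (int r - int k) = 0" by (simp only: R_col_1_initial) simp
    qed
    then show "fps_nth (Abs_fps (\<lambda>r. shift_act p (odd_row m m) (int r + 1))) r
        = fps_nth (fps_of_poly p * ?A) r"
      by (simp add: shift_act_def odd_row_last_eq_R_col_1[OF assms(1)] algebra_simps)
  qed
  moreover have "fps_nth (fps_of_poly (P_poly m)) 0 \<noteq> 0"
    using of_nat_odd_neq_0[of m] by (simp add: coeff_P_poly del: of_nat_add of_nat_mult of_nat_Suc)
  then have "fps_of_poly (P_poly m) \<noteq> 0" by auto
  then have "fps_of_poly p * ?A
      = (fps_of_poly (P_poly m) * ?A) * fps_of_poly p / fps_of_poly (P_poly m)"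
    by (simp add: mult_ac)
  ultimately show ?thesis unfolding R_col_1_gen_fun[OF assms(1)] by simp
qed

theorem theorem2:
  fixes m :: nat
  assumes "m \<ge> 1"
  shows
    "(\<forall>j r. j \<le> m - 1 \<longrightarrow>
        F_seq m (m - j) r = (\<Sum>k=0..j. of_nat ((j + k + 1) choose (2 * k + 1)) * F_seq m m (r - int k))
      \<and> G_seq m (m - j) r = - (\<Sum>k=0..j. of_nat ((j + k) choose (2 * k)) * F_seq m m (r - int k)))
   \<and> (\<forall>j' r. 1 \<le> j' \<and> j' \<le> m \<longrightarrow>
        F_seq m j' r = (\<Sum>k<m + 1 - j'. of_nat ((m - j' + k + 1) choose (2 * k + 1)) * F_seq m m (r - int k)))
   \<and> (\<forall>r. F_seq m m r = - G_seq m m r)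
   \<and> (\<forall>j. j \<le> m - 1 \<longrightarrow>
        Abs_fps (\<lambda>r. F_seq m (m - j) (int r + 1))
          = of_nat (2 * m + 1) * fps_of_poly (calQ_poly j) / fps_of_poly (P_poly m)
      \<and> Abs_fps (\<lambda>r. G_seq m (m - j) (int r + 1))
          = - (of_nat (2 * m + 1) * fps_of_poly (calP_poly j) / fps_of_poly (P_poly m))
      \<and> (\<exists>n. (\<Sum>i\<le>degree (calQ_poly j). coeff (calQ_poly j) i) = of_nat (fib n))
      \<and> (\<exists>n. (\<Sum>i\<le>degree (calP_poly j). coeff (calP_poly j) i) = of_nat (fib n)))
   \<and> (\<forall>j r. 1 \<le> j \<and> j \<le> m \<longrightarrow>
        F_seq m j r = (\<Sum>k=0..j - 1. of_nat (2 * j - 1) / of_nat (2 * k + 1)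
                         * of_nat ((j + k - 1) choose (2 * k)) * F_seq m 1 (r - int k)))
   \<and> (\<forall>j r. 1 \<le> j \<and> j \<le> m - 1 \<longrightarrow>
        G_seq m j r = 2 * F_seq m 1 r
          + (\<Sum>k=1..j. of_nat j / of_nat k * of_nat ((j + k - 1) choose (2 * k - 1))
                         * F_seq m 1 (r - int k)))"
proof (intro conjI allI impI; (elim conjE)?)
  have F: "F_seq m (m - j) r = odd_row m (m - j) r"
    and G: "G_seq m (m - j) r = even_row m (m - j) r" if "j \<le> m - 1" for j r
    using that assms by (simp_all add: F_seq_eq_odd_row G_seq_eq_even_row)
  have last: "F_seq m m r = odd_row m m r" for r using F[of 0] by simp
  {
    fix j :: nat and r :: int assume j: "j \<le> m - 1"
    show expansion_F: "F_seq m (m - j) r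
        = (\<Sum>k=0..j. of_nat ((j + k + 1) choose (2 * k + 1)) * F_seq m m (r - int k))"
      using rows_from_last[OF assms j, of r]
      by (simp add: F[OF j] last shift_act_eq[OF degree_calQ_poly] atLeast0AtMost
          del: binomial_Suc_Suc)
    show "G_seq m (m - j) r = - (\<Sum>k=0..j. of_nat ((j + k) choose (2 * k)) * F_seq m m (r - int k))"
      using rows_from_last[OF assms j, of r]
      by (simp add: G[OF j] last shift_act_eq[OF degree_calP_poly] atLeast0AtMost)
    note expansion_F
  }
  note expansion = this
  {
    fix j r assume "1 \<le> j" "j \<le> m"
    then have "m + 1 - j = Suc (m - j)" "m - (m - j) = j" "m - j \<le> m - 1" by simp_all
    then show "F_seq m j r
        = (\<Sum>k<m + 1 - j. of_nat ((m - j + k + 1) choose (2 * k + 1)) * F_seq m m (r - int k))"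
      using expansion[of "m - j" r] by (simp only: lessThan_Suc_atMost atLeast0AtMost)
  }
  {
    fix r show "F_seq m m r = - G_seq m m r"
      using F[of 0 r] G[of 0 r] by (simp only: odd_row_last even_row_last diff_zero)
  }
  {
    fix j assume j: "j \<le> m - 1"
    show "Abs_fps (\<lambda>r. F_seq m (m - j) (int r + 1))
        = of_nat (2 * m + 1) * fps_of_poly (calQ_poly j) / fps_of_poly (P_poly m)"
      using rows_from_last[OF assms j] j degree_calQ_poly[of j]
      by (simp only: F[OF j] gen_fun_shift_act[OF assms] le_trans)
    have "Abs_fps (\<lambda>r. G_seq m (m - j) (int r + 1))
        = - Abs_fps (\<lambda>r. shift_act (calP_poly j) (odd_row m m) (int r + 1))"
      using rows_from_last[OF assms j] by (intro fps_ext) (simp add: G[OF j])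
    then show "Abs_fps (\<lambda>r. G_seq m (m - j) (int r + 1))
        = - (of_nat (2 * m + 1) * fps_of_poly (calP_poly j) / fps_of_poly (P_poly m))"
      using gen_fun_shift_act[OF assms, of "calP_poly j"] j degree_calP_poly[of j] by simp
    show "\<exists>n. (\<Sum>i\<le>degree (calQ_poly j). coeff (calQ_poly j) i) = of_nat (fib n)"
      using poly_1_fib[of j] unfolding poly_altdef power_one mult_1_right by blast
    show "\<exists>n. (\<Sum>i\<le>degree (calP_poly j). coeff (calP_poly j) i) = of_nat (fib n)"
      using poly_1_fib[of j] unfolding poly_altdef power_one mult_1_right by blast
  }
  {
    fix j r assume j: "1 \<le> j" "j \<le> m"
    then have lt: "j - 1 < m" and Suc: "Suc (j - 1) = j" by simp_all
    have "2 * j - 1 = 2 * (j - 1) + 1" "\<And>k. j + k - 1 = j - 1 + k" using j by simp_all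
    then show "F_seq m j r = (\<Sum>k=0..j - 1. of_nat (2 * j - 1) / of_nat (2 * k + 1)
        * of_nat ((j + k - 1) choose (2 * k)) * F_seq m 1 (r - int k))"
      using rows_from_first[OF lt, of r] j
      by (simp only: Suc F_seq_eq_odd_row[OF order.refl assms] F_seq_eq_odd_row
          shift_act_eq[OF degree_P_poly] coeff_P_poly atLeast0AtMost)
  }
  {
    fix j r assume j: "1 \<le> j" "j \<le> m - 1"
    let ?p = "calP_poly j + calP_poly (j - 1)"
    have "degree ?p \<le> j"
      using degree_calP_poly[of j] degree_calP_poly[of "j - 1"] by (intro degree_add_le) auto
    moreover have "j - 1 < m" "Suc (j - 1) = j" "j \<le> m" using j by simp_all
    ultimately have "G_seq m j r = (\<Sum>k\<le>j. coeff ?p k * F_seq m 1 (r - int k))"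
      using rows_from_first[of "j - 1" m r] j(1)
      by (simp only: F_seq_eq_odd_row[OF order.refl assms] G_seq_eq_even_row shift_act_eq)
    also have "\<dots> = coeff ?p 0 * F_seq m 1 r + (\<Sum>k=1..j. coeff ?p k * F_seq m 1 (r - int k))"
      by (simp add: sum.atLeast_Suc_atMost flip: atLeast0AtMost)
    also have "(\<Sum>k=1..j. coeff ?p k * F_seq m 1 (r - int k))
        = (\<Sum>k=1..j. of_nat j / of_nat k * of_nat ((j + k - 1) choose (2 * k - 1))
             * F_seq m 1 (r - int k))"
      using j by (intro sum.cong refl) (simp only: coeff_calP_poly_pair atLeastAtMost_iff)
    finally show "G_seq m j r = 2 * F_seq m 1 r
        + (\<Sum>k=1..j. of_nat j / of_nat k * of_nat ((j + k - 1) choose (2 * k - 1))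
             * F_seq m 1 (r - int k))"
      by simp
  }
qed

end
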